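(* Let $m(x)=\prod_{j=1}^nx_j$ and $-\ell=u=1$, and let $(\tilde x,\tilde y)\in G$. Then: 1. (a) $(\tilde x,\tilde y)$ satisfies $1-y\ge 0$ exactly if and only if $\tilde x$ contains an even number of entries of value $-1$ and the remaining entries are of value $1$; (b) $(\tilde x,\tilde y)$ satisfies $1+y\ge 0$ exactly if and only if $\tilde x$ contains an odd number of entries of value $-1$ and the remaining entries are of value $1$. 2. $(\tilde x,\tilde y)$ satisfies $(n-1)+\sum_{j=1}^nx_j+(-1)^ny\ge 0$ exactly if and only if $\tilde x$ contains at least $n-1$ entries of value $-1$. 3. $(\tilde x,\tilde y)$ satisfies $(n-1)-\sum_{j=1}^nx_j+y\ge 0$ exactly if and only if $\tilde x$ contains at least $n-1$ entries of value $1$. 4. For each $t\in\{0,\dots,n-2\}$, $(\tilde x,\tilde y)$ satisfies $(n-1)-\left(\sum_{j=1}^{t+1}x_j-\sum_{j=t+2}^nx_j\right)+(-1)^{n-(t+1)}y\ge 0$ exactly if and only if $\tilde x$ differs from $x^{t+1}$ in at most one entry.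
   Context: Let $n\ge2$. Here $G=\{(x,y)\in\mathbb{R}^n\times\mathbb{R}: -1\le x_j\le 1\ (j=1,\dots,n),\ y=\prod_{j=1}^nx_j\}$. For $k=0,\dots,n$, $x^k\in\mathbb{R}^n$ denotes the point whose first $k$ entries equal $1$ and whose last $n-k$ entries equal $-1$. "Satisfied exactly" means satisfied with equality. *)

theory Defs
  imports Complex_Main "HOL-Library.FuncSet"
begin

text \<open>
  A point of \<open>\<real>\<^sup>n\<close> is a function on the index set \<open>{1..n}\<close> that takes the value
  \<open>undefined\<close> elsewhere, so that the function space \<open>{1..n} \<rightarrow>\<^sub>E UNIV\<close>
  is in bijection with \<open>\<real>\<^sup>n\<close>.
\<close>

definition multilinear_monomial :: "nat \<Rightarrow> (nat \<Rightarrow> real) \<Rightarrow> real" where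
  "multilinear_monomial n x = (\<Prod>j=1..n. x j)"

definition monomial_graph :: "nat \<Rightarrow> ((nat \<Rightarrow> real) \<times> real) set" where
  "monomial_graph n =
     {(x, y). x \<in> {1..n} \<rightarrow>\<^sub>E UNIV \<and> (\<forall>j\<in>{1..n}. -1 \<le> x j \<and> x j \<le> 1) \<and>
              y = multilinear_monomial n x}"

definition step_vertex :: "nat \<Rightarrow> nat \<Rightarrow> nat \<Rightarrow> real" where
  "step_vertex n k = (\<lambda>j\<in>{1..n}. if j \<le> k then 1 else -1)"

end

theory Submission
  imports Defs
begin

text \<open>
  The last three kinds of inequality are one inequality read at different vertices \<open>v\<close> of the
  cube. Multiplying each entry of \<open>x\<close> by the sign \<open>v j\<close> preserves the cube and moves \<open>v\<close> to the
  all-ones vector, so only \<open>(n - 1) - \<Sum> z + \<Prod> z \<ge> 0\<close> has to be analysed. Appending an entry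
  \<open>w\<close> to \<open>z\<close> increases its left-hand side by \<open>(1 - w) * (1 - \<Prod> z)\<close>, which is nonnegative on the
  cube. By induction the left-hand side is a sum of nonnegative terms, and following when all of
  them vanish gives the equality case: at most one entry differs from \<open>1\<close>
  (\<open>card_minus_sum_plus_prod\<close>, transported to every vertex by \<open>vertex_inequality_tight_iff\<close>).

  For \<open>1 - y\<close> and \<open>1 + y\<close> the point is that a product of numbers of absolute value at most \<open>1\<close> has
  absolute value \<open>1\<close> only if every factor has; its sign is then the parity of the number of
  entries \<open>-1\<close>.
\<close>

lemma abs_prod_le_1:
  fixes z :: "'a \<Rightarrow> real"
  assumes "\<And>j. j \<in> A \<Longrightarrow> \<bar>z j\<bar> \<le> 1"
  shows "\<bar>\<Prod>j\<in>A. z j\<bar> \<le> 1"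
  unfolding abs_prod using assms by (intro prod_le_1) auto

lemma abs_prod_eq_1_iff:
  fixes z :: "'a \<Rightarrow> real"
  assumes "finite A" and "\<And>j. j \<in> A \<Longrightarrow> \<bar>z j\<bar> \<le> 1"
  shows "\<bar>\<Prod>j\<in>A. z j\<bar> = 1 \<longleftrightarrow> (\<forall>j\<in>A. \<bar>z j\<bar> = 1)"
  using assms
proof (induction A rule: finite_induct)
  case (insert a F)
  have za: "\<bar>z a\<bar> \<le> 1" and P: "\<bar>\<Prod>j\<in>F. z j\<bar> \<le> 1"
    using insert.prems by (auto intro: abs_prod_le_1)
  have "\<bar>z a\<bar> * \<bar>\<Prod>j\<in>F. z j\<bar> = 1 \<longleftrightarrow> \<bar>z a\<bar> = 1 \<and> \<bar>\<Prod>j\<in>F. z j\<bar> = 1"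
    using mult_left_le[OF P abs_ge_zero[of "z a"]]
      mult_right_le_one_le[OF abs_ge_zero[of "\<Prod>j\<in>F. z j"] abs_ge_zero za] za P
    by (auto simp: mult.commute)
  then show ?case
    using insert by (auto simp: abs_mult)
qed simp

lemma prod_signs_eq_power_card:
  fixes z :: "'a \<Rightarrow> 'b::comm_ring_1"
  assumes "finite A" and "\<forall>j\<in>A. z j \<noteq> -1 \<longrightarrow> z j = 1"
  shows "(\<Prod>j\<in>A. z j) = (-1) ^ card {j\<in>A. z j = -1}"
proof -
  have "(\<Prod>j\<in>A. z j) = (\<Prod>j\<in>A. if z j = -1 then -1 else 1)"
    using assms(2) by (intro prod.cong) auto
  also have "\<dots> = (-1) ^ card {j\<in>A. z j = -1}"
    using assms(1) by (simp add: prod.inter_filter [symmetric])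
  finally show ?thesis .
qed

text \<open>
  Nonnegativity has to be proved together with the equality case: a sum of two terms can be split
  into its summands at value \<open>0\<close> only because both are known to be nonnegative.
\<close>
lemma card_minus_sum_plus_prod:
  fixes z :: "'a \<Rightarrow> real"
  assumes "finite A" and "\<And>j. j \<in> A \<Longrightarrow> \<bar>z j\<bar> \<le> 1"
  shows "(real (card A) - 1) - (\<Sum>j\<in>A. z j) + (\<Prod>j\<in>A. z j) \<ge> 0 \<and>
    ((real (card A) - 1) - (\<Sum>j\<in>A. z j) + (\<Prod>j\<in>A. z j) = 0 \<longleftrightarrow>
      card {j\<in>A. z j \<noteq> 1} \<le> 1)"
  using assms
proof (induction A rule: finite_induct)
  case (insert a F)
  define S where "S = (\<Sum>j\<in>F. z j)"
  define P where "P = (\<Prod>j\<in>F. z j)"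
  define g where "g = (real (card F) - 1) - S + P"
  have IH: "g \<ge> 0" "g = 0 \<longleftrightarrow> card {j\<in>F. z j \<noteq> 1} \<le> 1"
    using insert unfolding g_def S_def P_def by auto
  have za: "z a \<le> 1" and P: "P \<le> 1"
    using insert.prems abs_prod_le_1[of F z] unfolding P_def by (simp_all add: abs_le_iff)
  have split: "(real (card (insert a F)) - 1) - (\<Sum>j\<in>insert a F. z j) + (\<Prod>j\<in>insert a F. z j)
      = g + (1 - z a) * (1 - P)"
    using insert.hyps unfolding g_def S_def P_def by (simp add: algebra_simps)
  have nonneg: "(1 - z a) * (1 - P) \<ge> 0"
    using za P by simp
  \<comment> \<open>If the new entry is not \<open>1\<close>, vanishing forces \<open>P = 1\<close>, and then \<open>g = 0\<close> says that the
    nonnegative deficits \<open>1 - z j\<close> add up to \<open>0\<close>.\<close>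
  have all_one: "g = 0 \<and> P = 1 \<longleftrightarrow> (\<forall>j\<in>F. z j = 1)"
  proof
    assume "g = 0 \<and> P = 1"
    then have "(\<Sum>j\<in>F. 1 - z j) = 0"
      unfolding g_def S_def by (simp add: sum_subtractf)
    moreover have "\<forall>j\<in>F. 0 \<le> 1 - z j"
      using insert.prems by (auto simp: abs_le_iff)
    ultimately show "\<forall>j\<in>F. z j = 1"
      using insert.hyps(1) by (subst (asm) sum_nonneg_eq_0_iff) auto
  next
    assume "\<forall>j\<in>F. z j = 1"
    then show "g = 0 \<and> P = 1"
      unfolding g_def S_def P_def by simp
  qed
  have "g + (1 - z a) * (1 - P) = 0 \<longleftrightarrow> card {j\<in>insert a F. z j \<noteq> 1} \<le> 1"
  proof (cases "z a = 1")
    case True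
    then have "{j\<in>insert a F. z j \<noteq> 1} = {j\<in>F. z j \<noteq> 1}" by auto
    then show ?thesis using IH True by simp
  next
    case False
    then have "{j\<in>insert a F. z j \<noteq> 1} = insert a {j\<in>F. z j \<noteq> 1}" by auto
    then have "card {j\<in>insert a F. z j \<noteq> 1} \<le> 1 \<longleftrightarrow> (\<forall>j\<in>F. z j = 1)"
      using insert.hyps by auto
    moreover have "g + (1 - z a) * (1 - P) = 0 \<longleftrightarrow> g = 0 \<and> P = 1"
      using False IH(1) nonneg by (auto simp: add_nonneg_eq_0_iff)
    ultimately show ?thesis using all_one by simp
  qed
  then show ?case
    using split IH(1) nonneg by simp
qed simp

lemma vertex_inequality_tight_iff:
  fixes v x :: "'a \<Rightarrow> real"
  assumes "finite A" and "\<And>j. j \<in> A \<Longrightarrow> \<bar>x j\<bar> \<le> 1"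
    and v: "\<And>j. j \<in> A \<Longrightarrow> v j = 1 \<or> v j = -1"
  shows "(real (card A) - 1) - (\<Sum>j\<in>A. v j * x j) + (\<Prod>j\<in>A. v j) * (\<Prod>j\<in>A. x j) = 0 \<longleftrightarrow>
    card {j\<in>A. x j \<noteq> v j} \<le> 1"
proof -
  have abs: "\<bar>v j * x j\<bar> \<le> 1" if "j \<in> A" for j
    using assms(2)[OF that] v[OF that] by auto
  have "{j\<in>A. v j * x j \<noteq> 1} = {j\<in>A. x j \<noteq> v j}"
    using v by force
  with card_minus_sum_plus_prod[of A "\<lambda>j. v j * x j", OF assms(1) abs] show ?thesis
    by (simp add: prod.distrib)
qed

lemma card_ge_pred_iff_card_not_le_1:
  assumes "finite A"
  shows "card {j\<in>A. P j} \<ge> card A - 1 \<longleftrightarrow> card {j\<in>A. \<not> P j} \<le> 1"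
proof -
  have "A = {j\<in>A. P j} \<union> {j\<in>A. \<not> P j}" by auto
  then have "card A = card {j\<in>A. P j} + card {j\<in>A. \<not> P j}"
    using assms by (metis (no_types, lifting) card_Un_disjoint disjoint_iff finite_Un mem_Collect_eq)
  then show ?thesis by linarith
qed

theorem theorem6p2:
  fixes n :: nat and x :: "nat \<Rightarrow> real" and y :: real
  assumes "n \<ge> 2"
    and "(x, y) \<in> monomial_graph n"
  shows
    "(1 - y = 0 \<longleftrightarrow>
        even (card {j\<in>{1..n}. x j = -1}) \<and> (\<forall>j\<in>{1..n}. x j \<noteq> -1 \<longrightarrow> x j = 1)) \<and>
     (1 + y = 0 \<longleftrightarrow>
        odd (card {j\<in>{1..n}. x j = -1}) \<and> (\<forall>j\<in>{1..n}. x j \<noteq> -1 \<longrightarrow> x j = 1)) \<and>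
     ((real n - 1) + (\<Sum>j=1..n. x j) + (-1) ^ n * y = 0 \<longleftrightarrow>
        card {j\<in>{1..n}. x j = -1} \<ge> n - 1) \<and>
     ((real n - 1) - (\<Sum>j=1..n. x j) + y = 0 \<longleftrightarrow>
        card {j\<in>{1..n}. x j = 1} \<ge> n - 1) \<and>
     (\<forall>t\<in>{0..n-2}.
        (real n - 1) - ((\<Sum>j=1..t+1. x j) - (\<Sum>j=t+2..n. x j)) + (-1) ^ (n - (t+1)) * y = 0 \<longleftrightarrow>
        card {j\<in>{1..n}. x j \<noteq> step_vertex n (t+1) j} \<le> 1)"
proof -
  have y: "y = (\<Prod>j=1..n. x j)" and x: "\<And>j. j \<in> {1..n} \<Longrightarrow> \<bar>x j\<bar> \<le> 1"
    using assms(2) by (auto simp: monomial_graph_def multilinear_monomial_def abs_le_iff)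
  let ?signs = "\<forall>j\<in>{1..n}. x j \<noteq> -1 \<longrightarrow> x j = 1"
  have abs_y: "\<bar>y\<bar> = 1 \<longleftrightarrow> ?signs"
    using abs_prod_eq_1_iff[of "{1..n}" x] x unfolding y by fastforce
  have y_signs: "y = (-1) ^ card {j\<in>{1..n}. x j = -1}" if ?signs
    using prod_signs_eq_power_card[of "{1..n}" x] that unfolding y by simp
  have one: "1 - y = 0 \<longleftrightarrow> even (card {j\<in>{1..n}. x j = -1}) \<and> ?signs"
  proof (cases ?signs)
    case True
    then show ?thesis using y_signs by (cases "even (card {j\<in>{1..n}. x j = -1})") simp_all
  next
    case False
    then have "\<bar>y\<bar> \<noteq> 1" using abs_y by blast
    then have "1 - y \<noteq> 0" by auto
    then show ?thesis using False by blast
  qed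
  have minus_one: "1 + y = 0 \<longleftrightarrow> odd (card {j\<in>{1..n}. x j = -1}) \<and> ?signs"
  proof (cases ?signs)
    case True
    then show ?thesis using y_signs by (cases "even (card {j\<in>{1..n}. x j = -1})") simp_all
  next
    case False
    then have "\<bar>y\<bar> \<noteq> 1" using abs_y by blast
    then have "1 + y \<noteq> 0" by auto
    then show ?thesis using False by blast
  qed
  have tight: "(real n - 1) - (\<Sum>j=1..n. v j * x j) + (\<Prod>j=1..n. v j) * y = 0 \<longleftrightarrow>
      card {j\<in>{1..n}. x j \<noteq> v j} \<le> 1" if "\<And>j. j \<in> {1..n} \<Longrightarrow> v j = 1 \<or> v j = -1" for v
    using vertex_inequality_tight_iff[of "{1..n}" x v] x that unfolding y by simp
  have low: "(real n - 1) + (\<Sum>j=1..n. x j) + (-1) ^ n * y = 0 \<longleftrightarrow>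
      card {j\<in>{1..n}. x j = -1} \<ge> n - 1"
    using tight[of "\<lambda>_. -1"] card_ge_pred_iff_card_not_le_1[of "{1..n}" "\<lambda>j. x j = -1"]
    by (simp add: sum_negf)
  have high: "(real n - 1) - (\<Sum>j=1..n. x j) + y = 0 \<longleftrightarrow> card {j\<in>{1..n}. x j = 1} \<ge> n - 1"
    using tight[of "\<lambda>_. 1"] card_ge_pred_iff_card_not_le_1[of "{1..n}" "\<lambda>j. x j = 1"]
    by simp
  have step: "(real n - 1) - ((\<Sum>j=1..t+1. x j) - (\<Sum>j=t+2..n. x j)) + (-1) ^ (n - (t+1)) * y = 0
      \<longleftrightarrow> card {j\<in>{1..n}. x j \<noteq> step_vertex n (t+1) j} \<le> 1" if "t \<in> {0..n-2}" for t
  proof -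
    let ?v = "step_vertex n (t+1)"
    have union: "{1..n} = {1..t+1} \<union> {t+2..n}" and disj: "{1..t+1} \<inter> {t+2..n} = {}"
      using that assms(1) by auto
    have lo: "?v j = 1" if "j \<in> {1..t+1}" for j
      using that \<open>t \<in> {0..n-2}\<close> assms(1) unfolding step_vertex_def by auto
    have hi: "?v j = -1" if "j \<in> {t+2..n}" for j
      using that unfolding step_vertex_def by auto
    have "(\<Sum>j=1..n. ?v j * x j) = (\<Sum>j=1..t+1. ?v j * x j) + (\<Sum>j=t+2..n. ?v j * x j)"
      unfolding union by (rule sum.union_disjoint) (use disj in auto)
    also have "(\<Sum>j=1..t+1. ?v j * x j) = (\<Sum>j=1..t+1. x j)"
      by (rule sum.cong) (use lo in auto)
    also have "(\<Sum>j=t+2..n. ?v j * x j) = (\<Sum>j=t+2..n. - x j)"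
      by (rule sum.cong) (use hi in auto)
    finally have s: "(\<Sum>j=1..n. ?v j * x j) = (\<Sum>j=1..t+1. x j) - (\<Sum>j=t+2..n. x j)"
      by (simp add: sum_negf)
    have "(\<Prod>j=1..n. ?v j) = (\<Prod>j=1..t+1. ?v j) * (\<Prod>j=t+2..n. ?v j)"
      unfolding union by (rule prod.union_disjoint) (use disj in auto)
    also have "(\<Prod>j=1..t+1. ?v j) = 1"
      by (rule prod.neutral) (use lo in auto)
    also have "(\<Prod>j=t+2..n. ?v j) = (\<Prod>j=t+2..n. -1)"
      by (rule prod.cong) (use hi in auto)
    finally have p: "(\<Prod>j=1..n. ?v j) = (-1) ^ (n - (t+1))"
      by simp
    have "?v j = 1 \<or> ?v j = -1" if "j \<in> {1..n}" for j
      using that lo hi unfolding union by blast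
    from tight[of ?v, OF this] show ?thesis
      unfolding s p .
  qed
  from one minus_one low high step show ?thesis by blast
qed

end
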